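(* Let $\nabla$ be an $h$-connection of $E$ whose topological holonomy group $G_\nabla$ is contained in $SU(2)$. Then $G_\nabla$ is dense in $SU(2)$ if and only if $\Phi(G_\nabla)$ is dense in $SO(3)$.
   Context: Let $T^2=S^1\times S^1$ with $S^1=\mathbb{R}/2\pi\mathbb{Z}$ and let $\mathrm{pr}:\mathbb{R}^2\to T^2$ be the projection. $E$ is a complex vector bundle over $T^2$ of (complex) rank 2 with a Hermitian metric $h$; an $h$-connection is a connection $\nabla$ of $E$ with $\nabla h=0$. Let $\tilde v_1,\tilde v_2$ be an orthonormal basis of $\mathrm{pr}^*E_{(0,0)}$, and let $\tilde\xi_{i,x}$ (resp. $\tilde\xi_{i,y}$) be the $\nabla$-parallel sections of $\mathrm{pr}^*E$ along the $x$-axis (resp. $y$-axis) with value $\tilde v_i$ at $(0,0)$. Identifying the fibers of the pull-back at $(x+2\pi m,y+2\pi n)$ and $(x,y)$ for $m,n\in\mathbb{Z}$, there are $B_1,B_2\in U(2)$ with $(\tilde\xi_{1,x}(a+2\pi,0)\ \tilde\xi_{2,x}(a+2\pi,0))=(\tilde\xi_{1,x}(a,0)\ \tilde\xi_{2,x}(a,0))B_1$ and $(\tilde\xi_{1,y}(0,b+2\pi)\ \tilde\xi_{2,y}(0,b+2\pi))=(\tilde\xi_{1,y}(0,b)\ \tilde\xi_{2,y}(0,b))B_2$ for all $a,b\in\mathbb{R}$. The topological holonomy group $G_\nabla$ is the subgroup of $U(2)$ generated by $B_1,B_2$ (determined up to conjugation). $\Phi:SU(2)\to SO(3)$ is the double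 covering homomorphism given, for real $b_1,\dots,b_4$ with $b_1^2+b_2^2+b_3^2+b_4^2=1$, by $$\Phi\begin{pmatrix}b_1+\sqrt{-1}b_2&-b_3+\sqrt{-1}b_4\\ b_3+\sqrt{-1}b_4&b_1-\sqrt{-1}b_2\end{pmatrix}=\begin{pmatrix}b_1^2+b_2^2-b_3^2-b_4^2&2b_1b_4+2b_2b_3&-2b_1b_3+2b_2b_4\\ -2b_1b_4+2b_2b_3&b_1^2+b_3^2-b_2^2-b_4^2&2b_1b_2+2b_3b_4\\ 2b_1b_3+2b_2b_4&-2b_1b_2+2b_3b_4&b_1^2+b_4^2-b_2^2-b_3^2\end{pmatrix}.$$ *)

theory Defs
  imports "HOL-Analysis.Analysis" "HOL-Algebra.Generated_Groups"
begin

section \<open>The torus\<close>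

quotient_type circle = real / "\<lambda>x y. \<exists>k::int. y = x + 2 * pi * of_int k"
proof (rule equivpI)
  show "reflp (\<lambda>x y. \<exists>k::int. y = x + 2 * pi * of_int k)"
    by (rule reflpI) (rule exI[of _ 0], simp)
  show "symp (\<lambda>x y. \<exists>k::int. y = x + 2 * pi * of_int k)"
  proof (rule sympI, elim exE)
    fix x y :: real and k :: int assume "y = x + 2 * pi * of_int k"
    then show "\<exists>k::int. x = y + 2 * pi * of_int k" by (intro exI[of _ "-k"]) simp
  qed
  show "transp (\<lambda>x y. \<exists>k::int. y = x + 2 * pi * of_int k)"
  proof (rule transpI, elim exE)
    fix x y z :: real and k l :: int
    assume "y = x + 2 * pi * of_int k" "z = y + 2 * pi * of_int l"
    then show "\<exists>k::int. z = x + 2 * pi * of_int k"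
      by (intro exI[of _ "k + l"]) (simp add: algebra_simps)
  qed
qed

type_synonym torus = "circle \<times> circle"

definition pr :: "real \<times> real \<Rightarrow> torus"
  where "pr z = (abs_circle (fst z), abs_circle (snd z))"

text \<open>The topology and the smooth structure of the torus are the ones for which \<^term>\<open>pr\<close> is a
  local diffeomorphism: openness and smoothness are tested after composition with \<^term>\<open>pr\<close>.\<close>

definition torus_open :: "torus set \<Rightarrow> bool"
  where "torus_open U \<longleftrightarrow> open (pr -` U)"

primrec Ck_on ::
  "nat \<Rightarrow> 'a::euclidean_space set \<Rightarrow> ('a \<Rightarrow> 'b::real_normed_vector) \<Rightarrow> bool"
where
  "Ck_on 0 S f \<longleftrightarrow> continuous_on S f"
| "Ck_on (Suc k) S f \<longleftrightarrow>
     (\<exists>f'. (\<forall>x\<in>S. (f has_derivative f' x) (at x)) \<and> (\<forall>v. Ck_on k S (\<lambda>x. f' x v)))"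

definition torus_smooth_on :: "torus set \<Rightarrow> (torus \<Rightarrow> 'b::real_normed_vector) \<Rightarrow> bool"
  where "torus_smooth_on U f \<longleftrightarrow> (\<forall>k. Ck_on k (pr -` U) (f \<circ> pr))"

text \<open>A vector field is given by its two components in the global frame
  \<open>\<partial>/\<partial>x\<close>, \<open>\<partial>/\<partial>y\<close> of the tangent bundle.\<close>

type_synonym vfield = "torus \<Rightarrow> real \<times> real"

text \<open>The derivative \<open>X f\<close>. The choice of the preimage of \<open>p\<close> made by \<^term>\<open>inv_into UNIV pr\<close> is
  irrelevant, since \<open>f \<circ> pr\<close> is periodic.\<close>

definition vderiv :: "vfield \<Rightarrow> (torus \<Rightarrow> 'b::real_normed_vector) \<Rightarrow> torus \<Rightarrow> 'b"
  where "vderiv X f p = frechet_derivative (f \<circ> pr) (at (inv_into UNIV pr p)) (X p)"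


section \<open>Complex vector bundles of rank 2 over the torus\<close>

text \<open>The type \<^typ>\<open>'e\<close> is the total space. The operations \<open>vb_add\<close> and \<open>vb_scale\<close> are meant to be
  applied to vectors in a common fibre. The manifold structure of the total space is the one
  determined by the local trivializations in \<open>vb_atlas\<close>.\<close>

record 'e vbundle =
  vb_proj :: "'e \<Rightarrow> torus"
  vb_zero :: "torus \<Rightarrow> 'e"
  vb_add :: "'e \<Rightarrow> 'e \<Rightarrow> 'e"
  vb_scale :: "complex \<Rightarrow> 'e \<Rightarrow> 'e"
  vb_atlas :: "(torus set \<times> ('e \<Rightarrow> complex^2)) set"

definition fibre :: "'e vbundle \<Rightarrow> torus \<Rightarrow> 'e set"
  where "fibre E p = {u. vb_proj E u = p}"

text \<open>Fibrewise inverse of a local trivialization.\<close>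

definition triv_inv :: "'e vbundle \<Rightarrow> ('e \<Rightarrow> complex^2) \<Rightarrow> torus \<Rightarrow> complex^2 \<Rightarrow> 'e"
  where "triv_inv E \<phi> p w = the_inv_into (fibre E p) \<phi> w"

definition complex_vector_bundle_rank2 :: "'e vbundle \<Rightarrow> bool" where
  "complex_vector_bundle_rank2 E \<longleftrightarrow>
     (\<Union>(U, \<phi>)\<in>vb_atlas E. U) = UNIV \<and>
     (\<forall>p. vb_zero E p \<in> fibre E p) \<and>
     (\<forall>p. \<forall>u\<in>fibre E p. \<forall>v\<in>fibre E p. vb_add E u v \<in> fibre E p) \<and>
     (\<forall>p c. \<forall>u\<in>fibre E p. vb_scale E c u \<in> fibre E p) \<and>
     (\<forall>(U, \<phi>)\<in>vb_atlas E. torus_open U \<and>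
        (\<forall>p\<in>U. bij_betw \<phi> (fibre E p) UNIV \<and> \<phi> (vb_zero E p) = 0 \<and>
           (\<forall>u\<in>fibre E p. \<forall>v\<in>fibre E p. \<phi> (vb_add E u v) = \<phi> u + \<phi> v) \<and>
           (\<forall>c. \<forall>u\<in>fibre E p. \<phi> (vb_scale E c u) = c *s \<phi> u))) \<and>
     (\<forall>(U, \<phi>)\<in>vb_atlas E. \<forall>(V, \<psi>)\<in>vb_atlas E. \<forall>w.
        torus_smooth_on (U \<inter> V) (\<lambda>p. \<psi> (triv_inv E \<phi> p w)))"

definition smooth_section :: "'e vbundle \<Rightarrow> (torus \<Rightarrow> 'e) \<Rightarrow> bool" where
  "smooth_section E s \<longleftrightarrow>
     (\<forall>p. s p \<in> fibre E p) \<and> (\<forall>(U, \<phi>)\<in>vb_atlas E. torus_smooth_on U (\<phi> \<circ> s))"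

text \<open>Hermitian forms are complex linear in the first argument and conjugate linear in the second.\<close>

definition hermitian_metric :: "'e vbundle \<Rightarrow> ('e \<Rightarrow> 'e \<Rightarrow> complex) \<Rightarrow> bool" where
  "hermitian_metric E h \<longleftrightarrow>
     (\<forall>p. \<forall>u\<in>fibre E p. \<forall>v\<in>fibre E p.
        (\<forall>w\<in>fibre E p. h (vb_add E u v) w = h u w + h v w) \<and>
        (\<forall>c. h (vb_scale E c u) v = c * h u v) \<and>
        h v u = cnj (h u v)) \<and>
     (\<forall>p. \<forall>u\<in>fibre E p. u \<noteq> vb_zero E p \<longrightarrow> Re (h u u) > 0) \<and>
     (\<forall>(U, \<phi>)\<in>vb_atlas E. \<forall>w z.
        torus_smooth_on U (\<lambda>p. h (triv_inv E \<phi> p w) (triv_inv E \<phi> p z)))"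


section \<open>Connections\<close>

type_synonym 'e conn = "vfield \<Rightarrow> (torus \<Rightarrow> 'e) \<Rightarrow> torus \<Rightarrow> 'e"

definition is_connection :: "'e vbundle \<Rightarrow> 'e conn \<Rightarrow> bool" where
  "is_connection E D \<longleftrightarrow>
     (\<forall>X s. torus_smooth_on UNIV X \<and> smooth_section E s \<longrightarrow> smooth_section E (D X s)) \<and>
     (\<forall>(f :: torus \<Rightarrow> real) (g :: torus \<Rightarrow> real) X Y s.
        torus_smooth_on UNIV f \<and> torus_smooth_on UNIV g \<and>
        torus_smooth_on UNIV X \<and> torus_smooth_on UNIV Y \<and> smooth_section E s \<longrightarrow>
        D (\<lambda>p. f p *\<^sub>R X p + g p *\<^sub>R Y p) s =
          (\<lambda>p. vb_add E (vb_scale E (of_real (f p)) (D X s p))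
                        (vb_scale E (of_real (g p)) (D Y s p)))) \<and>
     (\<forall>X s t. torus_smooth_on UNIV X \<and> smooth_section E s \<and> smooth_section E t \<longrightarrow>
        D X (\<lambda>p. vb_add E (s p) (t p)) = (\<lambda>p. vb_add E (D X s p) (D X t p))) \<and>
     (\<forall>X (f :: torus \<Rightarrow> complex) s.
        torus_smooth_on UNIV X \<and> torus_smooth_on UNIV f \<and> smooth_section E s \<longrightarrow>
        D X (\<lambda>p. vb_scale E (f p) (s p)) =
          (\<lambda>p. vb_add E (vb_scale E (vderiv X f p) (s p)) (vb_scale E (f p) (D X s p))))"

text \<open>An \<open>h\<close>-connection is a connection with \<open>\<nabla>h = 0\<close>, that is
  \<open>X (h(s,t)) = h(\<nabla>\<^sub>X s, t) + h(s, \<nabla>\<^sub>X t)\<close>.\<close>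

definition h_connection :: "'e vbundle \<Rightarrow> ('e \<Rightarrow> 'e \<Rightarrow> complex) \<Rightarrow> 'e conn \<Rightarrow> bool" where
  "h_connection E h D \<longleftrightarrow> is_connection E D \<and>
     (\<forall>X s t. torus_smooth_on UNIV X \<and> smooth_section E s \<and> smooth_section E t \<longrightarrow>
        vderiv X (\<lambda>p. h (s p) (t p)) = (\<lambda>p. h (D X s p) (t p) + h (s p) (D X t p)))"


section \<open>Topological holonomy groups\<close>

text \<open>The fibre of the pull-back of \<open>E\<close> by \<^term>\<open>pr\<close> at \<open>z\<close> is the fibre of \<open>E\<close> at \<open>pr z\<close>, so the
  identification of the fibres at \<open>z\<close> and \<open>z + (2\<pi>m, 2\<pi>n)\<close> is the identity, and a section of the
  pull-back along the line \<open>a \<mapsto> a v\<close> through the origin is a map \<open>\<xi>\<close> with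
  \<open>\<xi> a\<close> in the fibre at \<open>pr (a v)\<close>.

  The pulled back connection is computed as usual: near \<open>a\<close> one writes
  \<open>\<xi> = f\<^sub>1 s\<^sub>1 + f\<^sub>2 s\<^sub>2\<close> along the line, where \<open>s\<^sub>1, s\<^sub>2\<close> are smooth sections of \<open>E\<close> forming a frame
  near \<open>pr (a v)\<close>, and the covariant derivative of \<open>\<xi>\<close> is
  \<open>f\<^sub>1' s\<^sub>1 + f\<^sub>2' s\<^sub>2 + f\<^sub>1 \<nabla>\<^sub>v s\<^sub>1 + f\<^sub>2 \<nabla>\<^sub>v s\<^sub>2\<close>; by the Leibniz rule this does not depend on the frame.
  Such frames exist globally as sections, by means of bump functions.\<close>

definition has_covariant_derivative_line ::
  "'e vbundle \<Rightarrow> 'e conn \<Rightarrow> real \<times> real \<Rightarrow> (real \<Rightarrow> 'e) \<Rightarrow> 'e \<Rightarrow> real \<Rightarrow> bool" where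
  "has_covariant_derivative_line E D v \<xi> e a \<longleftrightarrow>
     (\<exists>s1 s2 f1 f2 d1 d2.
        smooth_section E s1 \<and> smooth_section E s2 \<and>
        (let p = pr (a *\<^sub>R v) in
          (\<forall>c1 c2. vb_add E (vb_scale E c1 (s1 p)) (vb_scale E c2 (s2 p)) = vb_zero E p
              \<longrightarrow> c1 = 0 \<and> c2 = 0) \<and>
          (\<forall>\<^sub>F b in nhds a. \<xi> b = vb_add E (vb_scale E (f1 b) (s1 (pr (b *\<^sub>R v))))
                                          (vb_scale E (f2 b) (s2 (pr (b *\<^sub>R v))))) \<and>
          (f1 has_vector_derivative d1) (at a) \<and> (f2 has_vector_derivative d2) (at a) \<and>
          e = vb_add E
                (vb_add E (vb_scale E d1 (s1 p)) (vb_scale E d2 (s2 p)))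
                (vb_add E (vb_scale E (f1 a) (D (\<lambda>_. v) s1 p))
                          (vb_scale E (f2 a) (D (\<lambda>_. v) s2 p)))))"

definition parallel_along_line ::
  "'e vbundle \<Rightarrow> 'e conn \<Rightarrow> real \<times> real \<Rightarrow> (real \<Rightarrow> 'e) \<Rightarrow> bool" where
  "parallel_along_line E D v \<xi> \<longleftrightarrow>
     (\<forall>a. \<xi> a \<in> fibre E (pr (a *\<^sub>R v))) \<and>
     (\<forall>a. has_covariant_derivative_line E D v \<xi> (vb_zero E (pr (a *\<^sub>R v))) a)"

definition conj_transpose :: "complex^'n^'m \<Rightarrow> complex^'m^'n"
  where "conj_transpose A = (\<chi> i j. cnj (A $ j $ i))"

definition U2 :: "(complex^2^2) set"
  where "U2 = {A. conj_transpose A ** A = mat 1 \<and> A ** conj_transpose A = mat 1}"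

definition SU2 :: "(complex^2^2) set"
  where "SU2 = {A \<in> U2. det A = 1}"

definition SO3 :: "(real^3^3) set"
  where "SO3 = {A. rotation_matrix A}"

definition U2_group :: "(complex^2^2) monoid"
  where "U2_group = \<lparr>carrier = U2, mult = (\<lambda>A B. A ** B), one = mat 1\<rparr>"

text \<open>The group \<open>G\<close> depends, up to conjugation, on the orthonormal basis \<open>v1, v2\<close>; the following
  says that \<open>G\<close> is the topological holonomy group for one such choice.\<close>

definition topological_holonomy_group ::
  "'e vbundle \<Rightarrow> ('e \<Rightarrow> 'e \<Rightarrow> complex) \<Rightarrow> 'e conn \<Rightarrow> (complex^2^2) set \<Rightarrow> bool" where
  "topological_holonomy_group E h D G \<longleftrightarrow>
     (\<exists>(v :: 2 \<Rightarrow> 'e) (\<xi>x :: 2 \<Rightarrow> real \<Rightarrow> 'e) (\<xi>y :: 2 \<Rightarrow> real \<Rightarrow> 'e) B1 B2.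
        (\<forall>i. v i \<in> fibre E (pr (0, 0))) \<and>
        (\<forall>i j. h (v i) (v j) = (if i = j then 1 else 0)) \<and>
        (\<forall>i. parallel_along_line E D (1, 0) (\<xi>x i) \<and> \<xi>x i 0 = v i) \<and>
        (\<forall>i. parallel_along_line E D (0, 1) (\<xi>y i) \<and> \<xi>y i 0 = v i) \<and>
        B1 \<in> U2 \<and> B2 \<in> U2 \<and>
        (\<forall>a j. \<xi>x j (a + 2 * pi) =
           vb_add E (vb_scale E (B1 $ 1 $ j) (\<xi>x 1 a)) (vb_scale E (B1 $ 2 $ j) (\<xi>x 2 a))) \<and>
        (\<forall>b j. \<xi>y j (b + 2 * pi) =
           vb_add E (vb_scale E (B2 $ 1 $ j) (\<xi>y 1 b)) (vb_scale E (B2 $ 2 $ j) (\<xi>y 2 b))) \<and>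
        G = generate U2_group {B1, B2})"


section \<open>The double covering of \<open>SO(3)\<close>\<close>

text \<open>\<open>b1 + i b2\<close> and \<open>b3 + i b4\<close> are the entries of the first column; only the values on
  \<^term>\<open>SU2\<close> matter.\<close>

definition Phi :: "complex^2^2 \<Rightarrow> real^3^3" where
  "Phi A = (let b1 = Re (A $ 1 $ 1); b2 = Im (A $ 1 $ 1);
                b3 = Re (A $ 2 $ 1); b4 = Im (A $ 2 $ 1) in
     vector [
       vector [b1\<^sup>2 + b2\<^sup>2 - b3\<^sup>2 - b4\<^sup>2, 2 * b1 * b4 + 2 * b2 * b3, - 2 * b1 * b3 + 2 * b2 * b4],
       vector [- 2 * b1 * b4 + 2 * b2 * b3, b1\<^sup>2 + b3\<^sup>2 - b2\<^sup>2 - b4\<^sup>2, 2 * b1 * b2 + 2 * b3 * b4],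
       vector [2 * b1 * b3 + 2 * b2 * b4, - 2 * b1 * b2 + 2 * b3 * b4, b1\<^sup>2 + b4\<^sup>2 - b2\<^sup>2 - b3\<^sup>2]])"

end

theory Submission
  imports Defs
begin

text \<open>
  A holonomy group \<open>G\<close> is closed under multiplication, and the equivalence holds for every
  such \<open>G \<subseteq> SU(2)\<close> because of the shape of the double covering \<open>\<Phi> : SU(2) \<rightarrow> SO(3)\<close>.

  Since \<open>SU(2)\<close> is compact and \<open>\<Phi>\<close> is continuous, \<open>\<Phi>\<close> maps the closure of \<open>G\<close> onto the closure of
  \<open>\<Phi>(G)\<close>. As \<open>\<Phi>\<close> is onto \<open>SO(3)\<close>, density of \<open>G\<close> passes to \<open>\<Phi>(G)\<close>.

  Conversely, let \<open>H\<close> be the closure of \<open>G\<close> and let \<open>\<Phi>(H) = SO(3)\<close>. The fibres of \<open>\<Phi>\<close> are the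
  pairs \<open>\<plusminus>A\<close>, so \<open>H\<close> contains \<open>A\<close> or \<open>-A\<close> for each \<open>A \<in> SU(2)\<close>, and \<open>H = SU(2)\<close> follows once
  \<open>-1 \<in> H\<close>. Take \<open>A = diag(i, -i)\<close>: whichever of \<open>\<plusminus>A\<close> is in \<open>H\<close>, its square is \<open>-1\<close>, and \<open>H\<close> is
  closed under multiplication. This is \<open>eq_SU2_if_Phi_image_eq_SO3\<close>.

  Both properties of \<open>\<Phi>\<close> come from one observation. Write the elements of \<open>SU(2)\<close> as unit
  quaternions \<open>b\<close>. The entries of \<open>\<Phi>(b)\<close> determine, by the affine formulas
  \<open>quaternion_products\<close>, all products \<open>4 b\<^sub>i b\<^sub>k\<close>, that is, the matrix \<open>4 b b\<^sup>T\<close>; and this matrix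
  determines \<open>b\<close> up to sign, which describes the fibres. For surjectivity, apply the same formulas
  to an arbitrary rotation matrix. The result is again of the form \<open>4 b b\<^sup>T\<close>, since it has trace 4
  and enough of its \<open>2 \<times> 2\<close> minors vanish: they are linear combinations of the orthonormality
  relations and of the relations saying that a rotation matrix is its own cofactor matrix
  (\<open>quaternion_products_minors\<close>).
\<close>

section \<open>Unit quaternions\<close>

lemma vector_4 [simp]:
  "(vector [a, b, c, d] :: 'a::zero^4) $ 1 = a" "(vector [a, b, c, d] :: 'a::zero^4) $ 2 = b"
  "(vector [a, b, c, d] :: 'a::zero^4) $ 3 = c" "(vector [a, b, c, d] :: 'a::zero^4) $ 4 = d"
  by (simp_all add: vector_def)

definition su2_of :: "real^4 \<Rightarrow> complex^2^2" where
  "su2_of b = vector [vector [Complex (b$1) (b$2), Complex (- b$3) (b$4)],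
                      vector [Complex (b$3) (b$4), Complex (b$1) (- b$2)]]"

lemma su2_of_nth [simp]:
  "su2_of b $ 1 $ 1 = Complex (b$1) (b$2)" "su2_of b $ 1 $ 2 = Complex (- b$3) (b$4)"
  "su2_of b $ 2 $ 1 = Complex (b$3) (b$4)" "su2_of b $ 2 $ 2 = Complex (b$1) (- b$2)"
  by (simp_all add: su2_of_def)

lemma su2_of_uminus: "su2_of (- b) = - su2_of b"
  by (simp add: vec_eq_iff forall_2 complex_eq_iff)

lemma linear_su2_of: "linear su2_of"
  by (rule linearI) (simp_all add: vec_eq_iff forall_2 complex_eq_iff)

lemma norm_eq_1_real4:
  "norm (b :: real^4) = 1 \<longleftrightarrow> (b$1)\<^sup>2 + (b$2)\<^sup>2 + (b$3)\<^sup>2 + (b$4)\<^sup>2 = 1"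
  by (simp add: norm_eq_1 inner_vec_def sum_4 power2_eq_square)

text \<open>A unitary matrix of determinant 1 has its adjugate as conjugate transpose, so the first column
  determines the second one.\<close>

lemma SU2_second_column:
  assumes "A \<in> SU2"
  shows "A$2$2 = cnj (A$1$1)" "A$1$2 = - cnj (A$2$1)"
    "A$1$1 * cnj (A$1$1) + A$2$1 * cnj (A$2$1) = 1"
proof -
  have "(conj_transpose A ** A)$1$1 = 1" "(conj_transpose A ** A)$1$2 = 0"
    and d: "det A = 1"
    using assms by (simp_all add: SU2_def U2_def mat_def)
  then have n: "cnj (A$1$1) * A$1$1 + cnj (A$2$1) * A$2$1 = 1"
    and o: "cnj (A$1$1) * A$1$2 + cnj (A$2$1) * A$2$2 = 0"
    by (simp_all add: conj_transpose_def matrix_matrix_mult_def sum_2)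
  have d: "A$1$1 * A$2$2 - A$1$2 * A$2$1 = 1"
    using d by (simp add: det_2)
  show "A$2$2 = cnj (A$1$1)" using n o d by algebra
  show "A$1$2 = - cnj (A$2$1)" using n o d by algebra
  show "A$1$1 * cnj (A$1$1) + A$2$1 * cnj (A$2$1) = 1" using n by (simp add: mult.commute)
qed

lemma SU2_eq_image_sphere: "SU2 = su2_of ` sphere 0 1"
proof (intro equalityI subsetI)
  fix A assume A: "A \<in> SU2"
  define b :: "real^4" where
    "b = vector [Re (A$1$1), Im (A$1$1), Re (A$2$1), Im (A$2$1)]"
  have "A = su2_of b"
    using SU2_second_column(1,2)[OF A]
    by (simp add: vec_eq_iff forall_2 complex_eq_iff b_def)
  moreover have "norm b = 1"
    using arg_cong[OF SU2_second_column(3)[OF A], of Re]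
    by (simp add: norm_eq_1_real4 b_def power2_eq_square)
  ultimately show "A \<in> su2_of ` sphere 0 1" by auto
next
  fix A assume "A \<in> su2_of ` sphere 0 1"
  then obtain b where A: "A = su2_of b" and "norm b = 1" by auto
  then have b: "(b$1)\<^sup>2 + (b$2)\<^sup>2 + (b$3)\<^sup>2 + (b$4)\<^sup>2 = 1" by (simp add: norm_eq_1_real4)
  show "A \<in> SU2"
    using b unfolding A SU2_def U2_def
    by (simp add: vec_eq_iff forall_2 conj_transpose_def matrix_matrix_mult_def sum_2 mat_def
        complex_eq_iff det_2 power2_eq_square algebra_simps)
qed

lemma compact_SU2: "compact SU2"
  unfolding SU2_eq_image_sphere
  by (intro compact_continuous_image compact_sphere linear_continuous_on
      linear_conv_bounded_linear[THEN iffD1] linear_su2_of)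


section \<open>The double covering in terms of quaternions\<close>

lemma Phi_nth [simp]:
  "Phi A $ 1 $ 1 = (Re (A$1$1))\<^sup>2 + (Im (A$1$1))\<^sup>2 - (Re (A$2$1))\<^sup>2 - (Im (A$2$1))\<^sup>2"
  "Phi A $ 1 $ 2 = 2 * Re (A$1$1) * Im (A$2$1) + 2 * Im (A$1$1) * Re (A$2$1)"
  "Phi A $ 1 $ 3 = - 2 * Re (A$1$1) * Re (A$2$1) + 2 * Im (A$1$1) * Im (A$2$1)"
  "Phi A $ 2 $ 1 = - 2 * Re (A$1$1) * Im (A$2$1) + 2 * Im (A$1$1) * Re (A$2$1)"
  "Phi A $ 2 $ 2 = (Re (A$1$1))\<^sup>2 + (Re (A$2$1))\<^sup>2 - (Im (A$1$1))\<^sup>2 - (Im (A$2$1))\<^sup>2"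
  "Phi A $ 2 $ 3 = 2 * Re (A$1$1) * Im (A$1$1) + 2 * Re (A$2$1) * Im (A$2$1)"
  "Phi A $ 3 $ 1 = 2 * Re (A$1$1) * Re (A$2$1) + 2 * Im (A$1$1) * Im (A$2$1)"
  "Phi A $ 3 $ 2 = - 2 * Re (A$1$1) * Im (A$1$1) + 2 * Re (A$2$1) * Im (A$2$1)"
  "Phi A $ 3 $ 3 = (Re (A$1$1))\<^sup>2 + (Im (A$2$1))\<^sup>2 - (Im (A$1$1))\<^sup>2 - (Re (A$2$1))\<^sup>2"
  by (simp_all add: Phi_def Let_def)

lemma continuous_on_Phi: "continuous_on S Phi"
proof -
  have "continuous_on S (\<lambda>A. Phi A $ i $ j)" for i j
    using exhaust_3[of i] exhaust_3[of j]
    by (elim disjE; hypsubst; simp only: Phi_nth; intro continuous_intros)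
  then have "continuous_on S (\<lambda>A. \<chi> i j. Phi A $ i $ j)"
    by (intro continuous_on_vec_lambda)
  then show ?thesis by simp
qed

lemma Phi_in_SO3:
  assumes "A \<in> SU2"
  shows "Phi A \<in> SO3"
proof -
  obtain b where A: "A = su2_of b" and "norm b = 1"
    using assms by (auto simp: SU2_eq_image_sphere)
  then have b: "(b$1)\<^sup>2 + (b$2)\<^sup>2 + (b$3)\<^sup>2 + (b$4)\<^sup>2 = 1" by (simp add: norm_eq_1_real4)
  have "\<forall>i j. (transpose (Phi A) ** Phi A) $ i $ j =
      (((b$1)\<^sup>2 + (b$2)\<^sup>2 + (b$3)\<^sup>2 + (b$4)\<^sup>2)\<^sup>2 *\<^sub>R mat 1 :: real^3^3) $ i $ j"
    unfolding A forall_3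
    by (simp add: matrix_matrix_mult_def sum_3 transpose_def mat_def) (intro conjI; algebra)
  then have "orthogonal_matrix (Phi A)"
    by (simp add: orthogonal_matrix vec_eq_iff b)
  moreover have "det (Phi A) = ((b$1)\<^sup>2 + (b$2)\<^sup>2 + (b$3)\<^sup>2 + (b$4)\<^sup>2)^3"
    unfolding A det_3 by simp algebra
  ultimately show ?thesis by (simp add: SO3_def rotation_matrix_def b)
qed

text \<open>The affine formulas that recover the products \<open>4 b\<^sub>i b\<^sub>k\<close> from
  \<open>Phi (su2_of b)\<close>. The diagonal uses \<open>1 = |b|\<^sup>2\<close>. The factor 4 keeps the entries free of fractions.\<close>

definition quaternion_products :: "real^3^3 \<Rightarrow> real^4^4" where
  "quaternion_products R = vector [
     vector [1 + R$1$1 + R$2$2 + R$3$3, R$2$3 - R$3$2,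
             R$3$1 - R$1$3, R$1$2 - R$2$1],
     vector [R$2$3 - R$3$2, 1 + R$1$1 - R$2$2 - R$3$3,
             R$1$2 + R$2$1, R$1$3 + R$3$1],
     vector [R$3$1 - R$1$3, R$1$2 + R$2$1,
             1 - R$1$1 + R$2$2 - R$3$3, R$2$3 + R$3$2],
     vector [R$1$2 - R$2$1, R$1$3 + R$3$1,
             R$2$3 + R$3$2, 1 - R$1$1 - R$2$2 + R$3$3]]"

lemma quaternion_products_Phi:
  assumes "norm b = 1"
  shows "quaternion_products (Phi (su2_of b)) $ i $ k = 4 * (b$i * b$k)"
proof -
  have b: "(b$1)\<^sup>2 + (b$2)\<^sup>2 + (b$3)\<^sup>2 + (b$4)\<^sup>2 = 1" using assms by (simp add: norm_eq_1_real4)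
  have "\<forall>i k. quaternion_products (Phi (su2_of b)) $ i $ k = 4 * (b$i * b$k)"
    using b by (simp add: forall_4 quaternion_products_def power2_eq_square field_simps)
  then show ?thesis by blast
qed

lemma inj_quaternion_products: "inj quaternion_products"
proof (rule injI)
  fix R S assume "quaternion_products R = quaternion_products S"
  then show "R = S"
    by (simp add: vec_eq_iff forall_3 forall_4 quaternion_products_def)
qed

text \<open>If \<open>b\<^sub>i b\<^sub>k = c\<^sub>i c\<^sub>k\<close> for unit vectors, then \<open>(b \<bullet> c)\<^sup>2 = 1\<close>, which is the case of equality in
  the Cauchy-Schwarz inequality.\<close>

lemma unit_vectors_eq_up_to_sign:
  fixes b c :: "real^'n"
  assumes "norm b = 1" "norm c = 1" and eq: "\<And>i k. b$i * b$k = c$i * c$k"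
  shows "b = c \<or> b = - c"
proof -
  have "(b \<bullet> c)\<^sup>2 = (\<Sum>i\<in>UNIV. \<Sum>k\<in>UNIV. (b$i * c$i) * (b$k * c$k))"
    by (simp add: inner_vec_def power2_eq_square sum_product)
  also have "\<dots> = (\<Sum>i\<in>UNIV. \<Sum>k\<in>UNIV. (c$i * c$i) * (c$k * c$k))"
    using eq by (intro sum.cong refl) (metis mult.assoc mult.left_commute)
  also have "\<dots> = (c \<bullet> c)\<^sup>2"
    by (simp add: inner_vec_def power2_eq_square sum_product)
  finally have "(b \<bullet> c)\<^sup>2 = 1" using \<open>norm c = 1\<close> by (simp add: norm_eq_1)
  then have "b \<bullet> c = 1 \<or> b \<bullet> c = - 1" by (simp add: power2_eq_1_iff)
  then show ?thesis
  proof
    assume "b \<bullet> c = 1"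
    then have "(b - c) \<bullet> (b - c) = 0"
      using assms(1,2) by (simp add: norm_eq_1 inner_diff inner_commute)
    then show ?thesis by simp
  next
    assume "b \<bullet> c = - 1"
    then have "(b + c) \<bullet> (b + c) = 0"
      using assms(1,2) by (simp add: norm_eq_1 inner_add inner_commute)
    then show ?thesis by (simp add: eq_neg_iff_add_eq_0)
  qed
qed

proposition Phi_eq_imp_eq_up_to_sign:
  assumes "A \<in> SU2" "B \<in> SU2" "Phi A = Phi B"
  shows "A = B \<or> A = - B"
proof -
  obtain b c where A: "A = su2_of b" "norm b = 1" and B: "B = su2_of c" "norm c = 1"
    using assms(1,2) by (auto simp: SU2_eq_image_sphere)
  have "4 * (b$i * b$k) = 4 * (c$i * c$k)" for i k
    using quaternion_products_Phi[OF A(2)] quaternion_products_Phi[OF B(2)] assms(3) A B by metis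
  then have "b$i * b$k = c$i * c$k" for i k by simp
  then have "b = c \<or> b = - c" using unit_vectors_eq_up_to_sign A B by blast
  then show ?thesis using A B by (auto simp: su2_of_uminus)
qed


section \<open>Surjectivity of the double covering\<close>

text \<open>For a symmetric matrix, the first hypothesis is the vanishing of those \<open>2 \<times> 2\<close> minors that involve a
  diagonal entry. The vector is the column through a positive diagonal entry, divided by the square
  root of that entry.\<close>

lemma outer_product_if_minors_vanish:
  fixes K :: "real^'n^'n"
  assumes "\<And>i j k. K$i$j * K$k$j = K$i$k * K$j$j" and pos: "K$j$j > 0"
  obtains b :: "real^'n" where "\<And>i k. K$i$k = b$i * b$k"
proof
  fix i k
  show "K$i$k = (\<chi> i. K$i$j / sqrt (K$j$j)) $ i * (\<chi> i. K$i$j / sqrt (K$j$j)) $ k"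
    using assms(1)[of i j k] pos by (simp add: field_simps)
qed

text \<open>A rotation matrix is its own cofactor matrix because rotations preserve the cross product and
  each column is the image of an axis, hence the cross product of the other two columns.\<close>

lemma rotation_matrix_relations:
  fixes R :: "real^3^3"
  assumes "rotation_matrix R"
  shows "\<And>i j. R$i$1 * R$j$1 + R$i$2 * R$j$2 + R$i$3 * R$j$3 = (if i = j then 1 else 0)"
    and "\<And>i j. R$1$i * R$1$j + R$2$i * R$2$j + R$3$i * R$3$j = (if i = j then 1 else 0)"
    and "R$2$2 * R$3$3 - R$3$2 * R$2$3 = R$1$1" "R$3$2 * R$1$3 - R$1$2 * R$3$3 = R$2$1"
      "R$1$2 * R$2$3 - R$2$2 * R$1$3 = R$3$1"
    and "R$2$3 * R$3$1 - R$3$3 * R$2$1 = R$1$2" "R$3$3 * R$1$1 - R$1$3 * R$3$1 = R$2$2"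
      "R$1$3 * R$2$1 - R$2$3 * R$1$1 = R$3$2"
    and "R$2$1 * R$3$2 - R$3$1 * R$2$2 = R$1$3" "R$3$1 * R$1$2 - R$1$1 * R$3$2 = R$2$3"
      "R$1$1 * R$2$2 - R$2$1 * R$1$2 = R$3$3"
proof -
  have "R ** transpose R = mat 1" "transpose R ** R = mat 1"
    using assms by (auto simp: rotation_matrix_def orthogonal_matrix_def)
  then have "(R ** transpose R)$i$j = (if i = j then 1 else 0)"
    "(transpose R ** R)$i$j = (if i = j then 1 else 0)" for i j
    by (simp_all add: mat_def)
  then show "R$i$1 * R$j$1 + R$i$2 * R$j$2 + R$i$3 * R$j$3 = (if i = j then 1 else 0)"
    "R$1$i * R$1$j + R$2$i * R$2$j + R$3$i * R$3$j = (if i = j then 1 else 0)" for i j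
    by (simp_all add: matrix_matrix_mult_def sum_3 transpose_def)
  have "cross3 (R *v axis i 1) (R *v axis j 1) = R *v cross3 (axis i 1) (axis j 1)" for i j
    using assms by (rule cross_rotation_matrix)
  from this[of 2 3] this[of 3 1] this[of 1 2]
  show "R$2$2 * R$3$3 - R$3$2 * R$2$3 = R$1$1" "R$3$2 * R$1$3 - R$1$2 * R$3$3 = R$2$1"
      "R$1$2 * R$2$3 - R$2$2 * R$1$3 = R$3$1"
    "R$2$3 * R$3$1 - R$3$3 * R$2$1 = R$1$2" "R$3$3 * R$1$1 - R$1$3 * R$3$1 = R$2$2"
      "R$1$3 * R$2$1 - R$2$3 * R$1$1 = R$3$2"
    "R$2$1 * R$3$2 - R$3$1 * R$2$2 = R$1$3" "R$3$1 * R$1$2 - R$1$1 * R$3$2 = R$2$3"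
      "R$1$1 * R$2$2 - R$2$1 * R$1$2 = R$3$3"
    by (simp_all add: vec_eq_iff forall_3 cross3_def matrix_vector_mult_def sum_3 axis_def)
qed

text \<open>The difference of the two sides is of degree 2 in the entries of \<open>R\<close>, and it is a linear combination
  of the relations above.\<close>

lemma quaternion_products_minors:
  assumes "rotation_matrix R"
  defines "K \<equiv> quaternion_products R"
  shows "K$i$j * K$k$j = K$i$k * K$j$j"
proof -
  have "\<forall>i j. R$i$1 * R$j$1 + R$i$2 * R$j$2 + R$i$3 * R$j$3 = (if i = j then 1 else 0)"
    "\<forall>i j. R$1$i * R$1$j + R$2$i * R$2$j + R$3$i * R$3$j = (if i = j then 1 else 0)"
    using rotation_matrix_relations(1,2)[OF assms(1)] by blast+
  note rel = this[unfolded forall_3, simplified] rotation_matrix_relations(3-)[OF assms(1)]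
  have "\<forall>i j k. K$i$j * K$k$j = K$i$k * K$j$j"
    unfolding K_def quaternion_products_def forall_4 vector_4
    by (intro conjI; insert rel; elim conjE; simp only: algebra_simps)
  then show ?thesis by blast
qed

proposition SO3_subset_Phi_image: "SO3 \<subseteq> Phi ` SU2"
proof
  fix R assume "R \<in> SO3"
  then have R: "rotation_matrix R" by (simp add: SO3_def)
  define K where "K = quaternion_products R"
  \<comment> \<open>A column can be normalized as soon as its diagonal entry is positive; the trace provides one.\<close>
  have tr: "K$1$1 + K$2$2 + K$3$3 + K$4$4 = 4"
    by (simp add: K_def quaternion_products_def)
  then have "\<exists>j. K$j$j > 0" by (smt (verit))
  then obtain c where c: "\<And>i k. K$i$k = c$i * c$k"
    using outer_product_if_minors_vanish quaternion_products_minors[OF R] unfolding K_def by blast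
  define b where "b = (1/2) *\<^sub>R c"
  have b: "K$i$k = 4 * (b$i * b$k)" for i k by (simp add: c b_def)
  have "norm b = 1"
    using tr by (simp add: b norm_eq_1_real4 power2_eq_square)
  moreover from this have "quaternion_products (Phi (su2_of b)) = K"
    by (simp add: vec_eq_iff quaternion_products_Phi b)
  then have "Phi (su2_of b) = R"
    using inj_quaternion_products by (simp add: K_def inj_eq)
  ultimately show "R \<in> Phi ` SU2" by (force simp: SU2_eq_image_sphere)
qed

corollary Phi_image_SU2: "Phi ` SU2 = SO3"
  using Phi_in_SO3 SO3_subset_Phi_image by blast


section \<open>Closures\<close>

lemma closure_of_top_of_set_closed:
  assumes "closed S" "T \<subseteq> S"
  shows "top_of_set S closure_of T = closure T"
  using assms closure_minimal[OF assms(2,1)]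
  by (simp add: closure_of_subtopology inf_absorb2)

lemma closure_image_subset_compact:
  fixes f :: "'a::t2_space \<Rightarrow> 'b::t2_space"
  assumes "compact S" "continuous_on S f" "T \<subseteq> S"
  shows "closure (f ` T) = f ` closure T"
proof
  have cl: "closure T \<subseteq> S" using assms by (simp add: closure_minimal compact_imp_closed)
  then have cont: "continuous_on (closure T) f" using assms continuous_on_subset by blast
  show "f ` closure T \<subseteq> closure (f ` T)"
    by (rule image_closure_subset[OF cont]) (auto intro: closure_subset[THEN subsetD])
  have "compact (closure T)" using assms(1) cl closed_closure closed_Int_compact
    by (metis inf.absorb1)
  then have "closed (f ` closure T)" using cont by (intro compact_imp_closed compact_continuous_image)
  then show "closure (f ` T) \<subseteq> f ` closure T"
    by (intro closure_minimal image_mono closure_subset)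
qed

lemma matrix_mult_in_closure:
  fixes G :: "(complex^'n^'n) set"
  assumes mult: "\<And>A B. A \<in> G \<Longrightarrow> B \<in> G \<Longrightarrow> A ** B \<in> G"
    and "A \<in> closure G" "B \<in> closure G"
  shows "A ** B \<in> closure G"
proof -
  let ?m = "\<lambda>p :: (complex^'n^'n) \<times> (complex^'n^'n). fst p ** snd p"
  have "continuous_on (closure (G \<times> G)) ?m"
    unfolding matrix_matrix_mult_def by (intro continuous_on_vec_lambda continuous_intros)
  then have "?m ` closure (G \<times> G) \<subseteq> closure G"
    by (rule image_closure_subset) (use mult closure_subset in \<open>fastforce\<close>)+
  moreover have "(A, B) \<in> closure (G \<times> G)" using assms by (simp add: closure_Times)
  ultimately show ?thesis by force
qed


section \<open>Density of the holonomy group\<close>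

lemma topological_holonomy_group_mult:
  assumes "topological_holonomy_group E h D G" "A \<in> G" "B \<in> G"
  shows "A ** B \<in> G"
proof -
  obtain B1 B2 where G: "G = generate U2_group {B1, B2}"
    using assms(1) unfolding topological_holonomy_group_def by blast
  have "A \<otimes>\<^bsub>U2_group\<^esub> B \<in> G"
    using assms(2,3) unfolding G by (rule generate.eng)
  then show ?thesis by (simp add: U2_group_def)
qed

text \<open>The covering does not split, because the half turn \<open>Phi (diag(i, -i))\<close> has order 2 while both
  of its preimages have square \<open>-1\<close>.\<close>

proposition eq_SU2_if_Phi_image_eq_SO3:
  assumes "M \<subseteq> SU2" and mult: "\<And>A B. A \<in> M \<Longrightarrow> B \<in> M \<Longrightarrow> A ** B \<in> M"
    and "Phi ` M = SO3"
  shows "M = SU2"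
proof -
  have sign: "A \<in> M \<or> - A \<in> M" if "A \<in> SU2" for A
  proof -
    obtain B where "B \<in> M" "Phi A = Phi B"
      using Phi_in_SO3[OF \<open>A \<in> SU2\<close>] assms(3) by (metis imageE)
    then have "A = B \<or> A = - B" using Phi_eq_imp_eq_up_to_sign that assms(1) by blast
    then show ?thesis using \<open>B \<in> M\<close> by auto
  qed
  define J where "J = su2_of (axis 2 1)"
  have "J ** J = - mat 1" "(- J) ** (- J) = - mat 1"
    by (simp_all add: J_def vec_eq_iff forall_2 matrix_matrix_mult_def sum_2 mat_def
        complex_eq_iff axis_def)
  moreover have "J \<in> SU2"
    by (simp add: J_def SU2_eq_image_sphere norm_axis_1)
  ultimately have "- mat 1 \<in> M" using sign mult by metis
  moreover have "- mat 1 ** A = - A" for A :: "complex^2^2"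
    by (simp add: vec_eq_iff forall_2 matrix_matrix_mult_def mat_def sum_2)
  ultimately have neg: "- A \<in> M" if "A \<in> M" for A
    using mult[OF _ that] by metis
  have "A \<in> M" if "A \<in> SU2" for A
    using sign[OF that] neg[of "- A"] by auto
  then show ?thesis using assms(1) by blast
qed

theorem proposition8p3:
  fixes E :: "'e vbundle" and h :: "'e \<Rightarrow> 'e \<Rightarrow> complex" and D :: "'e conn"
    and G :: "(complex^2^2) set"
  assumes "complex_vector_bundle_rank2 E"
    and "hermitian_metric E h"
    and "h_connection E h D"
    and "topological_holonomy_group E h D G"
    and "G \<subseteq> SU2"
  shows "top_of_set SU2 closure_of G = SU2 \<longleftrightarrow> top_of_set SO3 closure_of (Phi ` G) = SO3"
proof -
  have closed: "closed SU2" "closed SO3"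
    using compact_SU2 compact_continuous_image[OF continuous_on_Phi compact_SU2]
    by (simp_all add: compact_imp_closed Phi_image_SU2)
  have "Phi ` G \<subseteq> SO3" using assms(5) Phi_in_SO3 by blast
  then have "top_of_set SO3 closure_of (Phi ` G) = Phi ` closure G"
    using closed(2) closure_image_subset_compact[OF compact_SU2 continuous_on_Phi assms(5)]
    by (simp add: closure_of_top_of_set_closed)
  moreover have "top_of_set SU2 closure_of G = closure G"
    using closed(1) assms(5) by (rule closure_of_top_of_set_closed)
  moreover have "closure G = SU2" if "Phi ` closure G = SO3"
  proof (rule eq_SU2_if_Phi_image_eq_SO3[OF _ _ that])
    show "closure G \<subseteq> SU2" using assms(5) closed(1) by (rule closure_minimal)
    show "A ** B \<in> closure G" if "A \<in> closure G" "B \<in> closure G" for A B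
      using topological_holonomy_group_mult[OF assms(4)] that by (rule matrix_mult_in_closure)
  qed
  ultimately show ?thesis using Phi_image_SU2 by auto
qed

end
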